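(* (1) Let $n,m$ be positive integers with $n>2m$, and put $n_1=n+m$ (so $n_1>3m$). Then for every sufficiently small $a>0$ (depending on $n,m$) and every sufficiently small $\varepsilon>0$ (depending on $n,m,a$), the mixed polynomial $\ell^{\varepsilon}_{n,m}$ given by the numerator of $$\bar z^m-\frac{z^{n-m}}{z^n-a^n}-\frac{\varepsilon}{z^m}$$ satisfies $\rho(\ell^{\varepsilon}_{n,m})=5(n_1-m)$. (2) (Case $n=2m$.) Let $m\ge 1$ and let $$f_{2m}(z,\bar z)=\bar z^{m}\left(z^{2m}-\tfrac12\right)-\left(z^m-\tfrac1{30}\right),$$ i.e. the numerator of $\bar z^m-\dfrac{z^m-1/30}{z^{2m}-1/2}$. Then $f_{2m}\in L(3m;2m,m)$ and $\rho(f_{2m})=5m$.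
   Context: A mixed polynomial of one variable is a finite sum $f(z,\bar z)=\sum a_{\nu,\mu}z^\nu\bar z^\mu$ with complex coefficients. $V(f)=\{z\in\mathbb C: f(z,\bar z)=0\}$ and $\rho(f)$ is the cardinality of $V(f)$ (number of roots, ignoring sign). For positive integers $N,m$, $L(N+m;N,m)$ denotes the set of mixed polynomials of the form $\bar z^m q(z)-p(z)$ with $p,q\in\mathbb C[z]$, $\deg q=N$, $\deg p\le N$. The numerator of $\bar z^m-\frac{z^{n-m}}{z^n-a^n}-\frac{\varepsilon}{z^m}$ is the mixed polynomial obtained by multiplying by $z^m(z^n-a^n)$, namely $\bar z^m z^m(z^n-a^n)-z^n-\varepsilon(z^n-a^n)$. *)

theory Defs
  imports Complex_Main "HOL-Computational_Algebra.Polynomial"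
begin

(* The outer variable stands for the conjugate of z, the inner one for z: the coefficient
   of z^nu * cnj z^mu in f is coeff (coeff f mu) nu. *)
type_synonym mixed_poly = "complex poly poly"

definition Zv :: mixed_poly where "Zv = [:[:0, 1:]:]"

definition Zbar :: mixed_poly where "Zbar = [:0, 1:]"

definition mconst :: "complex \<Rightarrow> mixed_poly" where "mconst c = [:[:c:]:]"

definition of_zpoly :: "complex poly \<Rightarrow> mixed_poly" where "of_zpoly p = [:p:]"

definition mixed_eval :: "mixed_poly \<Rightarrow> complex \<Rightarrow> complex" where
  "mixed_eval f z = poly (poly f [:cnj z:]) z"

lemma mixed_eval_altdef:
  "mixed_eval f z =
     (\<Sum>\<mu>\<le>degree f. \<Sum>\<nu>\<le>degree (coeff f \<mu>). coeff (coeff f \<mu>) \<nu> * z ^ \<nu> * cnj z ^ \<mu>)"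
  by (simp add: mixed_eval_def poly_altdef[of f] poly_sum poly_power poly_mult
      poly_altdef[of "coeff f _"] sum_distrib_right)

lemma mixed_eval_simps [simp]:
  "mixed_eval Zv z = z"
  "mixed_eval Zbar z = cnj z"
  "mixed_eval (mconst c) z = c"
  "mixed_eval (of_zpoly p) z = poly p z"
  "mixed_eval (f + g) z = mixed_eval f z + mixed_eval g z"
  "mixed_eval (f - g) z = mixed_eval f z - mixed_eval g z"
  "mixed_eval (f * g) z = mixed_eval f z * mixed_eval g z"
  "mixed_eval (f ^ k) z = mixed_eval f z ^ k"
  by (simp_all add: mixed_eval_def Zv_def Zbar_def mconst_def of_zpoly_def)

definition mixed_zeros :: "mixed_poly \<Rightarrow> complex set" where
  "mixed_zeros f = {z. mixed_eval f z = 0}"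

(* card is 0 on infinite sets, so only a positive value of rho certifies finiteness. *)
definition rho :: "mixed_poly \<Rightarrow> nat" where
  "rho f = card (mixed_zeros f)"

(* mixed_L k N m is L(k; N, m); the first parameter is redundant, being N + m. *)
definition mixed_L :: "nat \<Rightarrow> nat \<Rightarrow> nat \<Rightarrow> mixed_poly set" where
  "mixed_L k N m =
     {Zbar ^ m * of_zpoly q - of_zpoly p | p q. k = N + m \<and> degree q = N \<and> degree p \<le> N}"

definition ell :: "nat \<Rightarrow> nat \<Rightarrow> real \<Rightarrow> real \<Rightarrow> mixed_poly" where
  "ell n m a \<epsilon> =
     Zbar ^ m * Zv ^ m * (Zv ^ n - mconst (of_real a ^ n)) - Zv ^ n
       - mconst (of_real \<epsilon>) * (Zv ^ n - mconst (of_real a ^ n))"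

lemma ell_numerator:
  assumes "m \<le> n" "z \<noteq> 0" "z ^ n \<noteq> of_real a ^ n"
  shows "mixed_eval (ell n m a \<epsilon>) z =
    z ^ m * (z ^ n - of_real a ^ n) *
      (cnj z ^ m - z ^ (n - m) / (z ^ n - of_real a ^ n) - of_real \<epsilon> / z ^ m)"
proof -
  define D where "D = z ^ n - of_real a ^ n"
  have zn: "z ^ n = z ^ m * z ^ (n - m)"
    using assms(1) by (simp flip: power_add)
  have "D \<noteq> 0"
    using assms(3) by (simp add: D_def)
  then have "z ^ m * D * (cnj z ^ m - z ^ (n - m) / D - of_real \<epsilon> / z ^ m) =
      cnj z ^ m * z ^ m * D - z ^ m * z ^ (n - m) - of_real \<epsilon> * D"
    using assms(2) by (simp add: field_simps)
  then show ?thesis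
    by (simp add: ell_def D_def flip: zn)
qed

definition f2 :: "nat \<Rightarrow> mixed_poly" where
  "f2 m = Zbar ^ m * (Zv ^ (2 * m) - mconst (1 / 2)) - (Zv ^ m - mconst (1 / 30))"

end

theory Submission
  imports Defs
begin

text \<open>
  Both counts use a rotational symmetry. The zero set is a union of full fibres of a power
  map \<open>z \<mapsto> z ^ d\<close>, each with exactly \<open>d\<close> points, so it suffices to count nonzero values of \<open>z ^ d\<close>.

  For the first family put \<open>r = cmod z\<close> and \<open>b = a ^ n\<close>. The equation reads
  \<open>z ^ n * (r ^ (2*m) - 1 - \<epsilon>) = b * (r ^ (2*m) - \<epsilon>)\<close>, which forces \<open>z ^ n\<close> to be real. So
  \<open>z ^ n = \<sigma> * r ^ n\<close> with \<open>\<sigma> = 1\<close> or \<open>\<sigma> = -1\<close>, and \<open>r\<close> is a positive zero of the radial polynomial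
  \<open>r ^ n * (1 + \<epsilon> - r ^ (2*m)) + \<sigma> * b * (r ^ (2*m) - \<epsilon>)\<close>. Its coefficients change sign twice
  for \<open>\<sigma> = 1\<close> and three times for \<open>\<sigma> = -1\<close>. As in Descartes' rule of signs, repeated use of
  Rolle's theorem therefore allows at most two and at most three positive zeros, respectively. For small parameters
  the intermediate value theorem provides that many. For \<open>\<sigma> = 1\<close> they lie below
  \<open>r ^ (2*m) = \<epsilon>\<close> and above \<open>r ^ (2*m) = 1 + \<epsilon>\<close>. For \<open>\<sigma> = -1\<close> they lie between these two
  circles: in the limit \<open>\<epsilon> = 0\<close> the polynomial is \<open>r ^ (2*m) * (r ^ (n - 2*m) - r ^ n - b)\<close>, which
  because of \<open>2 * m < n\<close> is negative for small \<open>r\<close> and positive at \<open>r = 1/2\<close>, while for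
  \<open>\<epsilon> > 0\<close> it is positive at the inner circle and negative at the outer one.
  Each of the five pairs \<open>(\<sigma>, r)\<close> carries \<open>n\<close> zeros.

  For the second family put \<open>w = z ^ m = x + \<i> y\<close>. The imaginary part of the equation is
  \<open>y * (x\<^sup>2 + y\<^sup>2 - 1/2) = 0\<close>. The line \<open>y = 0\<close> leaves a real cubic with three zeros, and on the circle
  the real part forces \<open>x = 1/30\<close>, which gives two more.
\<close>

section \<open>Counting tools\<close>

lemma card_union_of_root_fibres:
  fixes c :: "'i \<Rightarrow> complex"
  assumes "0 < n" "finite I" "inj_on c I" "\<And>i. i \<in> I \<Longrightarrow> c i \<noteq> 0"
  shows "card {z. \<exists>i\<in>I. z ^ n = c i} = n * card I"
proof -
  have "{z. \<exists>i\<in>I. z ^ n = c i} = (\<Union>i\<in>I. {z. z ^ n = c i})"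
    by auto
  moreover have "card (\<Union>i\<in>I. {z. z ^ n = c i}) = (\<Sum>i\<in>I. card {z. z ^ n = c i})"
  proof (rule card_UN_disjoint)
    show "\<forall>i\<in>I. finite {z. z ^ n = c i}"
      using assms by (auto intro!: finite_nth_roots)
    show "\<forall>i\<in>I. \<forall>j\<in>I. i \<noteq> j \<longrightarrow> {z. z ^ n = c i} \<inter> {z. z ^ n = c j} = {}"
      using assms(3) by (auto simp: inj_on_def)
  qed (use assms in auto)
  ultimately show ?thesis
    using assms by (simp add: card_nth_roots mult.commute)
qed

text \<open>
  The factor \<open>w\<close> serves to discard powers of \<open>x\<close> from a derivative before the lemma
  is applied again; this is what turns Rolle's theorem into a bound in the style of Descartes' rule.
\<close>

lemma Rolle_card_positive_zeros:
  fixes f g w :: "real \<Rightarrow> real"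
  assumes deriv: "\<And>x. 0 < x \<Longrightarrow> (f has_real_derivative w x * g x) (at x)"
    and w: "\<And>x. 0 < x \<Longrightarrow> w x \<noteq> 0"
    and g: "finite {x. 0 < x \<and> g x = 0}" "card {x. 0 < x \<and> g x = 0} \<le> k"
  shows "finite {x. 0 < x \<and> f x = 0} \<and> card {x. 0 < x \<and> f x = 0} \<le> Suc k"
proof -
  have crit: "\<exists>z. x < z \<and> z < y \<and> g z = 0" if "0 < x" "x < y" "f x = 0" "f y = 0" for x y
  proof -
    have "\<exists>z>x. z < y \<and> (\<lambda>h. (w z * g z) * h) = (\<lambda>_. 0)"
    proof (rule Rolle_deriv)
      show "continuous_on {x..y} f"
        using that by (intro DERIV_continuous_on[where D = "\<lambda>x. w x * g x"] has_field_derivative_at_within[OF deriv]) auto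
      show "(f has_derivative (\<lambda>h. (w z * g z) * h)) (at z)" if "x < z" "z < y" for z
        using deriv[of z] that \<open>0 < x\<close> by (simp add: has_field_derivative_def)
    qed (use that in auto)
    then obtain z where z: "x < z" "z < y" "(\<lambda>h. (w z * g z) * h) = (\<lambda>_. 0)"
      by blast
    have "g z = 0"
      using fun_cong[OF z(3), of 1] w[of z] z(1) that by simp
    with z show ?thesis by blast
  qed
  \<comment> \<open>Adding a new largest zero of \<open>f\<close> adds a zero of \<open>g\<close> above all those counted so far.\<close>
  have bound: "A \<subseteq> {x. 0 < x \<and> f x = 0} \<longrightarrow> A \<noteq> {} \<longrightarrow>
      card A \<le> Suc (card {x. 0 < x \<and> x < Max A \<and> g x = 0})" if "finite A" for A
    using that
  proof (induction rule: finite_linorder_max_induct)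
    case empty
    then show ?case by simp
  next
    case (insert b A)
    show ?case
    proof (cases "A = {}")
      case True
      then show ?thesis by simp
    next
      case False
      show ?thesis
      proof (intro impI)
        assume sub: "insert b A \<subseteq> {x. 0 < x \<and> f x = 0}"
        have Max: "Max A \<in> A" "Max A < b"
          using insert False by auto
        have fin: "finite {x. 0 < x \<and> x < c \<and> g x = 0}" for c
          by (rule finite_subset[OF _ g(1)]) auto
        obtain z where z: "Max A < z" "z < b" "g z = 0"
          using crit[of "Max A" b] sub Max by auto
        have "0 < Max A"
          using sub Max by auto
        have "Max (insert b A) = b"
          using insert False Max by (intro Max_eqI) (auto intro: less_imp_le)
        have "card (insert b A) = Suc (card A)"
          using insert by (auto intro!: card_insert_disjoint)
        also have "\<dots> \<le> Suc (Suc (card {x. 0 < x \<and> x < Max A \<and> g x = 0}))"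
          using insert sub False by auto
        also have "Suc (card {x. 0 < x \<and> x < Max A \<and> g x = 0}) =
            card (insert z {x. 0 < x \<and> x < Max A \<and> g x = 0})"
          using z fin by simp
        also have "\<dots> \<le> card {x. 0 < x \<and> x < b \<and> g x = 0}"
          using z Max \<open>0 < Max A\<close> by (intro card_mono fin) auto
        finally show "card (insert b A) \<le> Suc (card {x. 0 < x \<and> x < Max (insert b A) \<and> g x = 0})"
          using \<open>Max (insert b A) = b\<close> by simp
      qed
    qed
  qed
  have small: "card A \<le> Suc k" if "finite A" "A \<subseteq> {x. 0 < x \<and> f x = 0}" for A
  proof (cases "A = {}")
    case False
    have "card {x. 0 < x \<and> x < Max A \<and> g x = 0} \<le> card {x. 0 < x \<and> g x = 0}"
      by (rule card_mono[OF g(1)]) auto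
    with bound[OF that(1)] that(2) False g(2) show ?thesis
      by force
  qed auto
  have "finite {x. 0 < x \<and> f x = 0}"
  proof (rule ccontr)
    assume "infinite {x. 0 < x \<and> f x = 0}"
    then obtain A where "A \<subseteq> {x. 0 < x \<and> f x = 0}" "finite A" "card A = Suc (Suc k)"
      using infinite_arbitrarily_large by blast
    with small[of A] show False by simp
  qed
  with small show ?thesis by blast
qed

lemma zero_between_opposite_signs:
  fixes f :: "real \<Rightarrow> real"
  assumes "x < y" "continuous_on {x..y} f" "f x * f y < 0"
  shows "\<exists>t. x < t \<and> t < y \<and> f t = 0"
proof -
  have "\<exists>t. x \<le> t \<and> t \<le> y \<and> f t = 0"
    using assms IVT'[of f x 0 y] IVT2'[of f y 0 x] by (auto simp: mult_less_0_iff)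
  then obtain t where "x \<le> t" "t \<le> y" "f t = 0"
    by blast
  moreover have "t \<noteq> x" "t \<noteq> y"
    using assms(3) \<open>f t = 0\<close> by auto
  ultimately show ?thesis by force
qed

lemma at_most_one_zero:
  fixes g :: "real \<Rightarrow> real"
  assumes "\<And>x y. 0 < x \<Longrightarrow> x < y \<Longrightarrow> g y < g x"
  shows "finite {x. 0 < x \<and> g x = 0}" "card {x. 0 < x \<and> g x = 0} \<le> Suc 0"
proof -
  have eq: "x = y" if "0 < x" "0 < y" "g x = 0" "g y = 0" for x y
    using assms[of x y] assms[of y x] that by (cases x y rule: linorder_cases) auto
  show fin: "finite {x. 0 < x \<and> g x = 0}"
  proof (cases "\<exists>x>0. g x = 0")
    case True
    then obtain x where "0 < x" "g x = 0" by blast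
    with eq have "{x. 0 < x \<and> g x = 0} \<subseteq> {x}"
      by blast
    then show ?thesis
      by (rule finite_subset) simp
  next
    case False
    then have "{x. 0 < x \<and> g x = 0} = {}"
      by blast
    then show ?thesis
      by (simp only: finite.emptyI)
  qed
  show "card {x. 0 < x \<and> g x = 0} \<le> Suc 0"
    unfolding card_le_Suc0_iff_eq[OF fin] using eq by blast
qed

section \<open>Positive zeros of the radial polynomial\<close>

text \<open>
  The sign \<open>\<sigma>\<close> is that of the real number \<open>z ^ n\<close>, and \<open>r\<close> is the modulus of \<open>z\<close>.
\<close>

definition radial :: "nat \<Rightarrow> nat \<Rightarrow> real \<Rightarrow> real \<Rightarrow> real \<Rightarrow> real \<Rightarrow> real" where
  "radial n m b \<epsilon> \<sigma> r = r ^ n * (1 + \<epsilon> - r ^ (2 * m)) + \<sigma> * b * (r ^ (2 * m) - \<epsilon>)"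

abbreviation radial_zeros :: "nat \<Rightarrow> nat \<Rightarrow> real \<Rightarrow> real \<Rightarrow> real \<Rightarrow> real set" where
  "radial_zeros n m b \<epsilon> \<sigma> \<equiv> {r. 0 < r \<and> radial n m b \<epsilon> \<sigma> r = 0}"

lemma continuous_on_radial: "continuous_on A (radial n m b \<epsilon> \<sigma>)"
  unfolding radial_def by (intro continuous_intros)

text \<open>
  For \<open>\<epsilon> > 0\<close> the coefficients have signs \<open>- + + -\<close>, from the highest exponent down. Division by \<open>r ^ n\<close>
  shifts the exponents so that the first \<open>+\<close> becomes a constant and the terms after it have negative
  exponents. Differentiation then kills the constant and flips the signs after it. What is left has signs
  \<open>- - +\<close>, is up to a power of \<open>r\<close> strictly decreasing, and so costs only one application of Rolle's theorem.
\<close>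

lemma card_radial_zeros_pos_le:
  assumes "0 < m" "2 * m < n" "0 < b"
  shows "finite (radial_zeros n m b \<epsilon> 1)" "card (radial_zeros n m b \<epsilon> 1) \<le> 2"
proof -
  obtain k where k: "n = 2 * m + k" "0 < k"
    using assms(2) less_imp_add_positive by blast
  define g where "g x = n * b * \<epsilon> - k * b * x ^ (2 * m) - 2 * m * x ^ (n + 2 * m)" for x :: real
  have g: "g y < g x" if "0 < x" "x < y" for x y
  proof -
    have "x ^ (2 * m) < y ^ (2 * m)" "x ^ (n + 2 * m) < y ^ (n + 2 * m)"
      using that assms by (auto intro!: power_strict_mono)
    then have "k * b * x ^ (2 * m) < k * b * y ^ (2 * m)" "2 * m * x ^ (n + 2 * m) < 2 * m * y ^ (n + 2 * m)"
      using assms k by auto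
    then show ?thesis unfolding g_def by linarith
  qed
  define f where "f x = 1 + \<epsilon> - x ^ (2 * m) + b * (x ^ (2 * m) - \<epsilon>) / x ^ n" for x
  obtain l where l: "2 * m = Suc l"
    using assms(1) by (cases "2 * m") auto
  have n: "n = Suc (l + k)" using k l by simp
  have L: "2 * real m = Suc l"
    using arg_cong[OF l, of real] by simp
  have deriv: "(f has_real_derivative (1 / x ^ Suc n) * g x) (at x)" if "0 < x" for x
  proof -
    define A B where "A = x ^ l" and "B = x ^ k"
    have AB: "A \<noteq> 0" "B \<noteq> 0"
      using that by (auto simp: A_def B_def)
    define Q where "Q = x * (x * A * B)"
    have pows: "x ^ (2 * m - 1) = A" "x ^ (2 * m) = x * A" "x ^ (n - 1) = A * B" "x ^ n = x * A * B"
      by (simp_all only: l n A_def B_def diff_Suc_1 power_Suc power_add mult.assoc)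
    have "Q \<noteq> 0"
      using that AB by (simp add: Q_def)
    have "(f has_real_derivative - (2 * m * x ^ (2 * m - 1)) +
        (b * (2 * m * x ^ (2 * m - 1)) * x ^ n - b * (x ^ (2 * m) - \<epsilon>) * (n * x ^ (n - 1))) / (x ^ n * x ^ n)) (at x)"
      unfolding f_def using that by (auto intro!: derivative_eq_intros)
    also have "- (2 * m * x ^ (2 * m - 1)) +
        (b * (2 * m * x ^ (2 * m - 1)) * x ^ n - b * (x ^ (2 * m) - \<epsilon>) * (n * x ^ (n - 1))) / (x ^ n * x ^ n) =
        - (Suc l * A) + (b * (Suc l * A) * (x * A * B) - b * (x * A - \<epsilon>) * (n * (A * B))) / ((x * A * B) * (x * A * B))"
      by (simp only: pows L of_nat_mult of_nat_numeral)
    also have "\<dots> = - (Suc l * A) +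
        ((b * Suc l * A * x - b * (x * A - \<epsilon>) * n) * (A * B)) / (Q * (A * B))"
      by (intro arg_cong2[where f = "(+)"] arg_cong2[where f = "(/)"] refl)
        (simp_all add: Q_def algebra_simps)
    also have "\<dots> = - (Suc l * A) + (b * Suc l * A * x - b * (x * A - \<epsilon>) * n) / Q"
      using AB by (subst nonzero_mult_divide_mult_cancel_right) auto
    also have "\<dots> = 1 / Q * (n * b * \<epsilon> - k * b * (x * A) - Suc l * A * Q)"
    proof -
      have "- (Suc l * A) = - (Suc l * A * Q) / Q"
        using \<open>Q \<noteq> 0\<close> by simp
      moreover have "real n = Suc l + k"
        by (simp add: n)
      ultimately show ?thesis
        by (simp only: add_divide_distrib[symmetric] times_divide_eq_left mult_1_left)
          (simp add: algebra_simps)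
    qed
    also have "\<dots> = (1 / x ^ Suc n) * g x"
    proof -
      have "x ^ Suc n = Q" "x ^ (n + 2 * m) = A * Q"
        by (simp_all only: power_Suc power_add pows Q_def) (simp_all add: mult_ac)
      then have "1 / x ^ Suc n * g x = 1 / Q * (n * b * \<epsilon> - k * b * (x * A) - 2 * real m * (A * Q))"
        by (simp only: g_def pows of_nat_mult of_nat_numeral)
      then show ?thesis
        unfolding L by (simp only: mult_ac)
    qed
    finally show ?thesis .
  qed
  have "f r = radial n m b \<epsilon> 1 r / r ^ n" if "0 < r" for r
    using that by (simp add: f_def radial_def field_simps)
  then have "{r. 0 < r \<and> f r = 0} = radial_zeros n m b \<epsilon> 1"
    by auto
  with Rolle_card_positive_zeros[OF deriv _ at_most_one_zero[of g, OF g]]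
  show "finite (radial_zeros n m b \<epsilon> 1)" "card (radial_zeros n m b \<epsilon> 1) \<le> 2"
    by (simp_all add: numeral_2_eq_2)
qed

text \<open>
  In the order of falling exponents the terms carry, for positive \<open>b\<close> and \<open>\<epsilon>\<close>, the signs \<open>- + - +\<close>.
  Differentiation drops the last term, and so again after a power of \<open>r\<close> is cancelled. What remains
  is, up to a power of \<open>r\<close>, a constant minus a multiple of \<open>r ^ (2*m)\<close>, which has at most one positive zero.
\<close>

lemma card_radial_zeros_neg_le:
  assumes "0 < m" "2 * m < n"
  shows "finite (radial_zeros n m b \<epsilon> (-1))" "card (radial_zeros n m b \<epsilon> (-1)) \<le> 3"
proof -
  obtain k where k: "n = 2 * m + k" "0 < k"
    using assms(2) less_imp_add_positive by blast
  obtain l where l: "2 * m = Suc l"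
    using assms(1) by (cases "2 * m") auto
  define g where "g x = n * (1 + \<epsilon>) * x ^ k - (n + 2 * m) * x ^ n - 2 * m * b" for x :: real
  define h where "h x = n * (k * (1 + \<epsilon>) - (n + 2 * m) * x ^ (2 * m))" for x :: real
  have h: "h y < h x" if "0 < x" "x < y" for x y
  proof -
    have "x ^ (2 * m) < y ^ (2 * m)"
      using that assms by (auto intro!: power_strict_mono)
    then show ?thesis
      unfolding h_def using assms by simp
  qed
  have g_deriv: "(g has_real_derivative x ^ (k - 1) * h x) (at x)" if "0 < x" for x
  proof -
    have "(g has_real_derivative
        n * (1 + \<epsilon>) * (k * x ^ (k - 1)) - (n + 2 * m) * (n * x ^ (n - 1))) (at x)"
      unfolding g_def by (auto intro!: derivative_eq_intros)
    also have "x ^ (n - 1) = x ^ (k - 1) * x ^ (2 * m)"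
      using k by (simp flip: power_add add: add.commute)
    finally show ?thesis
      by (simp add: h_def algebra_simps)
  qed
  have radial_deriv: "(radial n m b \<epsilon> (-1) has_real_derivative x ^ l * g x) (at x)" if "0 < x" for x
  proof -
    have "radial n m b \<epsilon> (-1) = (\<lambda>x. (1 + \<epsilon>) * x ^ n - x ^ (n + 2 * m) - b * x ^ (2 * m) + b * \<epsilon>)"
      by (auto simp: radial_def power_add algebra_simps)
    moreover have "((\<lambda>x. (1 + \<epsilon>) * x ^ n - x ^ (n + 2 * m) - b * x ^ (2 * m) + b * \<epsilon>) has_real_derivative
        (1 + \<epsilon>) * (n * x ^ (n - 1)) - (n + 2 * m) * x ^ (n + 2 * m - 1) - b * (2 * m * x ^ (2 * m - 1))) (at x)"
      by (auto intro!: derivative_eq_intros)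
    moreover have "x ^ (n - 1) = x ^ l * x ^ k" "x ^ (n + 2 * m - 1) = x ^ l * x ^ n" "x ^ (2 * m - 1) = x ^ l"
      using k l by (simp_all flip: power_add add: add_ac)
    ultimately show ?thesis
      by (simp add: g_def algebra_simps)
  qed
  from Rolle_card_positive_zeros[OF g_deriv _ at_most_one_zero[of h, OF h]]
  have "finite {x. 0 < x \<and> g x = 0}" "card {x. 0 < x \<and> g x = 0} \<le> Suc (Suc 0)"
    by simp_all
  from Rolle_card_positive_zeros[OF radial_deriv _ this]
  show "finite (radial_zeros n m b \<epsilon> (-1))" "card (radial_zeros n m b \<epsilon> (-1)) \<le> 3"
    by (simp_all add: numeral_3_eq_3)
qed

text \<open>
  Here the signs at \<open>0 < r\<^sub>0 < r\<^sub>1 < 2\<close> are \<open>- + + -\<close>, where \<open>r\<^sub>0\<close> and \<open>r\<^sub>1\<close> are the two radii at which one of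
  the summands of the radial polynomial vanishes.
\<close>

lemma radial_zeros_pos_ge:
  assumes "0 < m" "2 * m < n" "0 < b" "b < 1" "0 < \<epsilon>" "\<epsilon> < 1"
  shows "\<exists>r s. 0 < r \<and> r < s \<and> radial n m b \<epsilon> 1 r = 0 \<and> radial n m b \<epsilon> 1 s = 0"
proof -
  define r\<^sub>0 where "r\<^sub>0 = root (2 * m) \<epsilon>"
  define r\<^sub>1 where "r\<^sub>1 = root (2 * m) (1 + \<epsilon>)"
  have r0: "0 < r\<^sub>0" "r\<^sub>0 ^ (2 * m) = \<epsilon>" and r1: "r\<^sub>0 < r\<^sub>1" "r\<^sub>1 ^ (2 * m) = 1 + \<epsilon>"
    using assms by (auto simp: r\<^sub>0_def r\<^sub>1_def)
  have four: "(4::real) \<le> 2 ^ (2 * m)"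
    using power_increasing[of 2 "2 * m" "2::real"] assms by simp
  have eight: "(8::real) \<le> 2 ^ n"
    using power_increasing[of 3 n "2::real"] assms by simp
  have "r\<^sub>1 < 2"
  proof (rule ccontr)
    assume "\<not> r\<^sub>1 < 2"
    then have "2 ^ (2 * m) \<le> r\<^sub>1 ^ (2 * m)"
      by (intro power_mono) auto
    with r1 four assms show False by linarith
  qed
  have at0: "radial n m b \<epsilon> 1 0 < 0"
    using assms by (simp add: radial_def zero_power)
  have at_r0: "0 < radial n m b \<epsilon> 1 r\<^sub>0"
    unfolding radial_def r0 using r0 by simp
  have at_r1: "0 < radial n m b \<epsilon> 1 r\<^sub>1"
    unfolding radial_def r1 using assms by simp
  have at2: "radial n m b \<epsilon> 1 2 < 0"
  proof -
    have aux: "1 * (c - \<epsilon>) < 8 * (c - 1 - \<epsilon>)" if "4 \<le> c" for c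
    proof -
      have "0 < 7 * (c - 4) + 7 * (1 - \<epsilon>) + 13"
        using that assms(6) by simp
      also have "\<dots> = 8 * (c - 1 - \<epsilon>) - 1 * (c - \<epsilon>)"
        by (simp add: algebra_simps)
      finally show ?thesis by simp
    qed
    have "b * (2 ^ (2 * m) - \<epsilon>) \<le> 1 * (2 ^ (2 * m) - \<epsilon>)"
      using four assms by (intro mult_right_mono) auto
    also have "\<dots> < 8 * (2 ^ (2 * m) - 1 - \<epsilon>)"
      by (rule aux[OF four])
    also have "\<dots> \<le> 2 ^ n * (2 ^ (2 * m) - 1 - \<epsilon>)"
      using eight four assms by (intro mult_right_mono) auto
    finally have "b * (2 ^ (2 * m) - \<epsilon>) < 2 ^ n * (2 ^ (2 * m) - 1 - \<epsilon>)" .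
    then show ?thesis
      by (simp add: radial_def algebra_simps)
  qed
  obtain r where "0 < r" "r < r\<^sub>0" "radial n m b \<epsilon> 1 r = 0"
    using zero_between_opposite_signs[OF r0(1) continuous_on_radial mult_neg_pos[OF at0 at_r0]]
    by blast
  moreover obtain s where "r\<^sub>1 < s" "radial n m b \<epsilon> 1 s = 0"
    using zero_between_opposite_signs[OF \<open>r\<^sub>1 < 2\<close> continuous_on_radial mult_pos_neg[OF at_r1 at2]]
    by blast
  ultimately show ?thesis
    using r1 by (intro exI[of _ r] exI[of _ s]) auto
qed

text \<open>
  With the same radii the signs at \<open>r\<^sub>0 < u < v < r\<^sub>1\<close> are \<open>+ - + -\<close>.
\<close>

lemma radial_zeros_neg_ge:
  assumes "0 < m" "0 < b" "0 < \<epsilon>" "0 < u" "\<epsilon> < u ^ (2 * m)" "u < v" "v < 1"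
    and "radial n m b \<epsilon> (-1) u < 0" "0 < radial n m b \<epsilon> (-1) v"
  shows "\<exists>r s t. 0 < r \<and> r < s \<and> s < t \<and>
    radial n m b \<epsilon> (-1) r = 0 \<and> radial n m b \<epsilon> (-1) s = 0 \<and> radial n m b \<epsilon> (-1) t = 0"
proof -
  define r\<^sub>0 where "r\<^sub>0 = root (2 * m) \<epsilon>"
  define r\<^sub>1 where "r\<^sub>1 = root (2 * m) (1 + \<epsilon>)"
  have r0: "0 < r\<^sub>0" "r\<^sub>0 ^ (2 * m) = \<epsilon>" and r1: "1 < r\<^sub>1" "r\<^sub>1 ^ (2 * m) = 1 + \<epsilon>"
    using assms by (auto simp: r\<^sub>0_def r\<^sub>1_def)
  have "r\<^sub>0 < u"
    using assms r0 by (intro power_less_imp_less_base[of r\<^sub>0 "2 * m" u]) auto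
  have "v < r\<^sub>1"
    using r1 assms by linarith
  have at_r0: "0 < radial n m b \<epsilon> (-1) r\<^sub>0"
    unfolding radial_def r0 using r0 by simp
  have at_r1: "radial n m b \<epsilon> (-1) r\<^sub>1 < 0"
    unfolding radial_def r1 using assms by simp
  obtain r where "r\<^sub>0 < r" "r < u" "radial n m b \<epsilon> (-1) r = 0"
    using zero_between_opposite_signs[OF \<open>r\<^sub>0 < u\<close> continuous_on_radial mult_pos_neg[OF at_r0 assms(8)]]
    by blast
  moreover obtain s where "u < s" "s < v" "radial n m b \<epsilon> (-1) s = 0"
    using zero_between_opposite_signs[OF assms(6) continuous_on_radial mult_neg_pos[OF assms(8,9)]]
    by blast
  moreover obtain t where "v < t" "radial n m b \<epsilon> (-1) t = 0"
    using zero_between_opposite_signs[OF \<open>v < r\<^sub>1\<close> continuous_on_radial mult_pos_neg[OF assms(9) at_r1]]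
    by blast
  ultimately show ?thesis
    using r0 by (intro exI[of _ r] exI[of _ s] exI[of _ t]) auto
qed

text \<open>
  The signs of the limit \<open>r ^ (2*m) * (r ^ (n - 2*m) - r ^ n - b)\<close> persist for small \<open>\<epsilon>\<close>.
  The point \<open>b / 2\<close> is small enough since \<open>(b / 2) ^ (n - 2*m) \<le> b / 2\<close>.
\<close>

lemma eventually_radial_neg_signs:
  assumes "0 < m" "2 * m < n" "0 < b" "b < 1" "b < (1/2) ^ (n - 2 * m) - (1/2) ^ n"
  shows "\<forall>\<^sub>F \<epsilon> in at_right 0. \<epsilon> < (b / 2) ^ (2 * m) \<and>
    radial n m b \<epsilon> (-1) (b / 2) < 0 \<and> 0 < radial n m b \<epsilon> (-1) (1 / 2)"
proof -
  have lim: "((\<lambda>\<epsilon>. radial n m b \<epsilon> (-1) r) \<longlongrightarrow> radial n m b 0 (-1) r) (at_right 0)" for r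
    unfolding radial_def by (intro tendsto_intros)
  have limit: "radial n m b 0 (-1) r = r ^ (2 * m) * (r ^ (n - 2 * m) - r ^ n - b)" for r
  proof -
    have "r ^ n = r ^ (2 * m) * r ^ (n - 2 * m)"
      using assms by (simp flip: power_add)
    then show ?thesis
      by (simp add: radial_def algebra_simps)
  qed
  have "(b / 2) ^ (n - 2 * m) \<le> (b / 2) ^ 1"
    using assms by (intro power_decreasing) auto
  moreover have "0 < (b / 2) ^ n"
    using assms by simp
  ultimately have "(b / 2) ^ (n - 2 * m) - (b / 2) ^ n - b < 0"
    using assms(3) unfolding power_one_right by linarith
  then have "radial n m b 0 (-1) (b / 2) < 0"
    unfolding limit using assms by (intro mult_pos_neg) auto
  moreover have "0 < radial n m b 0 (-1) (1 / 2)"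
    unfolding limit using assms by (intro mult_pos_pos) auto
  moreover have "\<forall>\<^sub>F \<epsilon> in at_right 0. \<epsilon> < (b / 2) ^ (2 * m)"
    using assms by (intro order_tendstoD[OF tendsto_ident_at]) auto
  ultimately show ?thesis
    by (intro eventually_conj) (auto intro: order_tendstoD[OF lim])
qed

section \<open>The zeros of the first family\<close>

text \<open>
  Since \<open>cnj z ^ m * z ^ m\<close> is a function of the modulus, \<open>z ^ n\<close> is a quotient of real numbers. The
  denominator cannot vanish, because then the equation would read \<open>0 = a ^ n\<close>.
\<close>

lemma ell_zero_iff:
  assumes "0 < n" "0 < m" "0 < a" "0 < \<epsilon>"
  shows "mixed_eval (ell n m a \<epsilon>) z = 0 \<longleftrightarrow>
    (\<exists>(\<sigma>, r) \<in> Sigma {1, -1} (radial_zeros n m (a ^ n) \<epsilon>). z ^ n = of_real (\<sigma> * r ^ n))"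
proof -
  define r where "r = cmod z"
  define D where "D = r ^ (2 * m) - 1 - \<epsilon>"
  have "cnj z ^ m * z ^ m = (z * cnj z) ^ m"
    by (simp add: power_mult_distrib)
  also have "\<dots> = of_real (r ^ (2 * m))"
    by (simp only: complex_norm_square[symmetric] of_real_power power_mult r_def)
  finally have norm: "cnj z ^ m * z ^ m = of_real (r ^ (2 * m))" .
  have eval: "mixed_eval (ell n m a \<epsilon>) z = z ^ n * of_real D - of_real (a ^ n * (r ^ (2 * m) - \<epsilon>))"
    by (simp add: ell_def norm) (simp add: D_def algebra_simps)
  show ?thesis
  proof
    assume "mixed_eval (ell n m a \<epsilon>) z = 0"
    then have eq: "z ^ n * of_real D = of_real (a ^ n * (r ^ (2 * m) - \<epsilon>))"
      by (simp add: eval)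
    have "D \<noteq> 0"
    proof
      assume "D = 0"
      with eq have "a ^ n * (r ^ (2 * m) - \<epsilon>) = 0"
        by (metis mult_zero_right of_real_0 of_real_eq_0_iff)
      with \<open>D = 0\<close> assms show False
        by (simp add: D_def)
    qed
    have "z \<noteq> 0"
    proof
      assume "z = 0"
      with eq assms show False
        by (simp add: r_def zero_power)
    qed
    then have "0 < r" by (simp add: r_def)
    define x where "x = a ^ n * (r ^ (2 * m) - \<epsilon>) / D"
    have zx: "z ^ n = of_real x"
      using eq \<open>D \<noteq> 0\<close> by (simp add: x_def field_simps)
    have "\<bar>x\<bar> = r ^ n"
      using zx by (metis norm_of_real norm_power r_def)
    define \<sigma> where "\<sigma> = sgn x"
    have "x = \<sigma> * r ^ n" "\<sigma> = 1 \<or> \<sigma> = -1"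
      using \<open>\<bar>x\<bar> = r ^ n\<close> \<open>0 < r\<close> by (auto simp: \<sigma>_def sgn_if)
    moreover have "x * D = a ^ n * (r ^ (2 * m) - \<epsilon>)"
      using \<open>D \<noteq> 0\<close> by (simp add: x_def)
    ultimately have "radial n m (a ^ n) \<epsilon> \<sigma> r = 0"
      by (auto simp: radial_def D_def algebra_simps)
    then show "\<exists>(\<sigma>, r) \<in> Sigma {1, -1} (radial_zeros n m (a ^ n) \<epsilon>). z ^ n = of_real (\<sigma> * r ^ n)"
      using zx \<open>x = \<sigma> * r ^ n\<close> \<open>\<sigma> = 1 \<or> \<sigma> = -1\<close> \<open>0 < r\<close> by auto
  next
    assume "\<exists>(\<sigma>, r) \<in> Sigma {1, -1} (radial_zeros n m (a ^ n) \<epsilon>). z ^ n = of_real (\<sigma> * r ^ n)"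
    then obtain \<sigma> s where s: "\<sigma> = 1 \<or> \<sigma> = -1" "0 < s" "radial n m (a ^ n) \<epsilon> \<sigma> s = 0"
      and zs: "z ^ n = of_real (\<sigma> * s ^ n)"
      by blast
    have "r ^ n = s ^ n"
      using arg_cong[OF zs, of cmod] s by (auto simp: r_def norm_power norm_mult simp flip: of_real_power)
    then have "r = s"
      using assms s by (auto simp: r_def intro: power_eq_imp_eq_base)
    have "\<sigma> * s ^ n * D = a ^ n * (r ^ (2 * m) - \<epsilon>)"
      using s by (auto simp: radial_def D_def \<open>r = s\<close> algebra_simps)
    then show "mixed_eval (ell n m a \<epsilon>) z = 0"
      unfolding eval zs by (metis diff_self of_real_mult)
  qed
qed

lemma rho_ell_eq:
  assumes "0 < n" "0 < m" "0 < a" "0 < \<epsilon>"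
    and "finite (radial_zeros n m (a ^ n) \<epsilon> 1)" "finite (radial_zeros n m (a ^ n) \<epsilon> (-1))"
  shows "rho (ell n m a \<epsilon>) =
    n * (card (radial_zeros n m (a ^ n) \<epsilon> 1) + card (radial_zeros n m (a ^ n) \<epsilon> (-1)))"
proof -
  define I where "I = Sigma {1, -1} (radial_zeros n m (a ^ n) \<epsilon>)"
  define c where "c = (\<lambda>(\<sigma>, r). complex_of_real (\<sigma> * r ^ n))"
  have fin: "finite I"
    using assms unfolding I_def by (intro finite_SigmaI) auto
  have cI: "card I = card (radial_zeros n m (a ^ n) \<epsilon> 1) + card (radial_zeros n m (a ^ n) \<epsilon> (-1))"
    unfolding I_def using assms by (subst card_SigmaI) auto
  have inj: "inj_on c I"
  proof (rule inj_onI)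
    fix i j assume "i \<in> I" "j \<in> I" "c i = c j"
    then obtain \<sigma> r \<tau> s where ij: "i = (\<sigma>, r)" "j = (\<tau>, s)" "\<sigma> = 1 \<or> \<sigma> = -1" "\<tau> = 1 \<or> \<tau> = -1" "0 < r" "0 < s"
      by (auto simp: I_def)
    then have eq: "\<sigma> * r ^ n = \<tau> * s ^ n"
      using \<open>c i = c j\<close> unfolding c_def by (metis case_prod_conv of_real_eq_iff)
    have "0 < r ^ n" "0 < s ^ n"
      using ij by auto
    have "r ^ n = s ^ n"
      using arg_cong[OF eq, of abs] ij by (auto simp: abs_mult)
    with eq ij have "\<sigma> = \<tau>"
      by simp
    with \<open>r ^ n = s ^ n\<close> show "i = j"
      using ij assms by (auto intro: power_eq_imp_eq_base)
  qed
  have nz: "c i \<noteq> 0" if "i \<in> I" for i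
    using that by (auto simp: I_def c_def)
  have "mixed_zeros (ell n m a \<epsilon>) = {z. \<exists>i\<in>I. z ^ n = c i}"
    unfolding mixed_zeros_def ell_zero_iff[OF assms(1-4)] I_def c_def by (simp add: case_prod_unfold)
  then show ?thesis
    unfolding rho_def using card_union_of_root_fibres[OF assms(1) fin inj nz] cI by simp
qed

lemma eventually_rho_ell:
  assumes "0 < m" "2 * m < n"
  shows "\<forall>\<^sub>F a in at_right 0. \<forall>\<^sub>F \<epsilon> in at_right 0. rho (ell n m a \<epsilon>) = 5 * n"
proof -
  have "0 < n" using assms by simp
  have lim: "((\<lambda>a::real. a ^ n) \<longlongrightarrow> 0) (at_right 0)"
    using \<open>0 < n\<close> by (auto intro!: tendsto_eq_intros)
  have gap: "(0::real) < (1/2) ^ (n - 2 * m) - (1/2) ^ n"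
    using assms by (simp add: power_strict_decreasing)
  have "\<forall>\<^sub>F a in at_right (0::real). 0 < a \<and> a ^ n < 1 \<and> a ^ n < (1/2) ^ (n - 2 * m) - (1/2) ^ n"
    by (intro eventually_conj eventually_at_right_less order_tendstoD(2)[OF lim] gap) simp
  then show ?thesis
  proof eventually_elim
    case (elim a)
    define b where "b = a ^ n"
    have a: "0 < a" and b: "0 < b" "b < 1" "b < (1/2) ^ (n - 2 * m) - (1/2) ^ n"
      using elim by (auto simp: b_def)
    have "\<forall>\<^sub>F \<epsilon> in at_right (0::real). 0 < \<epsilon> \<and> \<epsilon> < 1"
      by (intro eventually_conj eventually_at_right_less order_tendstoD(2)[OF tendsto_ident_at]) simp
    with eventually_radial_neg_signs[OF assms b] show ?case
    proof eventually_elim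
      case (elim \<epsilon>)
      note pos = card_radial_zeros_pos_le[OF assms b(1), of \<epsilon>]
      note neg = card_radial_zeros_neg_le[OF assms, of b \<epsilon>]
      obtain r s where rs: "0 < r" "r < s" "radial n m b \<epsilon> 1 r = 0" "radial n m b \<epsilon> 1 s = 0"
        using radial_zeros_pos_ge[OF assms b(1,2), of \<epsilon>] elim by auto
      have "card {r, s} \<le> card (radial_zeros n m b \<epsilon> 1)"
        using rs pos elim by (intro card_mono) auto
      then have two: "card (radial_zeros n m b \<epsilon> 1) = 2"
        using rs pos elim by simp
      obtain t u v where tuv: "0 < t" "t < u" "u < v"
        "radial n m b \<epsilon> (-1) t = 0" "radial n m b \<epsilon> (-1) u = 0" "radial n m b \<epsilon> (-1) v = 0"
        using radial_zeros_neg_ge[OF assms(1) b(1), of \<epsilon> "b / 2" "1 / 2" n] elim b by auto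
      have "card {t, u, v} \<le> card (radial_zeros n m b \<epsilon> (-1))"
        using tuv neg elim by (intro card_mono) auto
      then have three: "card (radial_zeros n m b \<epsilon> (-1)) = 3"
        using tuv neg elim by simp
      show ?case
        using rho_ell_eq[OF \<open>0 < n\<close> assms(1) a, of \<epsilon>] pos neg two three elim
        by (simp add: b_def)
    qed
  qed
qed

section \<open>The zeros of the second family\<close>

lemma f2_in_mixed_L: "1 \<le> m \<Longrightarrow> f2 m \<in> mixed_L (3 * m) (2 * m) m"
proof -
  assume "1 \<le> m"
  define q p :: "complex poly" where "q = monom 1 (2 * m) - [:1/2:]" and "p = monom 1 m - [:1/30:]"
  have pow: "Zv ^ k = of_zpoly (monom 1 k)" for k
    by (induction k) (auto simp: Zv_def of_zpoly_def monom_Suc one_pCons monom_0)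
  have "f2 m = Zbar ^ m * of_zpoly q - of_zpoly p"
    unfolding f2_def pow by (simp add: q_def p_def mconst_def of_zpoly_def)
  moreover have "degree q = 2 * m"
    unfolding q_def diff_conv_add_uminus using \<open>1 \<le> m\<close>
    by (subst degree_add_eq_left) (auto simp: degree_monom_eq)
  moreover have "degree p \<le> 2 * m"
    unfolding p_def by (intro degree_diff_le) (auto intro: order.trans[OF degree_monom_le])
  ultimately show ?thesis
    unfolding mixed_L_def by auto
qed

lemma card_cubic_zeros:
  "finite {x::real. x ^ 3 - 3/2 * x + 1/30 = 0} \<and> card {x::real. x ^ 3 - 3/2 * x + 1/30 = 0} = 3"
proof -
  define f :: "real \<Rightarrow> real" where "f = (\<lambda>x. x ^ 3 - 3/2 * x + 1/30)"
  define P :: "real poly" where "P = [:1/30, -3/2, 0, 1:]"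
  have P: "P \<noteq> 0" "degree P = 3" "\<And>x. poly P x = f x"
    by (auto simp: P_def f_def algebra_simps power3_eq_cube)
  have fin: "finite {x. f x = 0}" and le: "card {x. f x = 0} \<le> 3"
    using poly_roots_finite[OF P(1)] card_poly_roots_bound[OF P(1)] P(2,3) by auto
  have cont: "continuous_on A f" for A
    unfolding f_def by (intro continuous_intros)
  obtain x where x: "-2 < x" "x < 0" "f x = 0"
    using zero_between_opposite_signs[OF _ cont, of "-2" 0] by (auto simp: f_def)
  obtain y where y: "0 < y" "y < 1" "f y = 0"
    using zero_between_opposite_signs[OF _ cont, of 0 1] by (auto simp: f_def)
  obtain z where z: "1 < z" "z < 2" "f z = 0"
    using zero_between_opposite_signs[OF _ cont, of 1 2] by (auto simp: f_def)
  have "card {x, y, z} \<le> card {x. f x = 0}"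
    using x y z by (intro card_mono fin) auto
  then show ?thesis
    using x y z fin le by (simp add: f_def)
qed

lemma reduced_f2_zeros:
  defines "W \<equiv> {w. cnj w * (w\<^sup>2 - 1/2) - (w - 1/30) = 0}"
  shows "finite W \<and> card W = 5"
proof -
  define X where "X = {x::real. x ^ 3 - 3/2 * x + 1/30 = 0}"
  \<comment> \<open>\<open>Complex (1/30) y\<close> lies on the circle of squared radius \<open>1/2\<close>, as \<open>449/900 = 1/2 - (1/30)\<^sup>2\<close>.\<close>
  define y where "y = sqrt (449/900)"
  have y: "0 < y" "y\<^sup>2 = 449/900"
    by (auto simp: y_def)
  have iff: "w \<in> W \<longleftrightarrow> Re w * ((Re w)\<^sup>2 + (Im w)\<^sup>2 - 3/2) + 1/30 = 0 \<and>
      Im w * ((Re w)\<^sup>2 + (Im w)\<^sup>2 - 1/2) = 0" for w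
    unfolding W_def by (simp add: complex_eq_iff power2_eq_square algebra_simps)
  have "W = of_real ` X \<union> {Complex (1/30) y, Complex (1/30) (-y)}"
  proof (intro set_eqI iffI)
    fix w assume "w \<in> W"
    show "w \<in> of_real ` X \<union> {Complex (1/30) y, Complex (1/30) (-y)}"
    proof (cases "Im w = 0")
      case True
      then have "w = of_real (Re w)"
        by (simp add: complex_eq_iff)
      moreover have "Re w \<in> X"
        using \<open>w \<in> W\<close> True unfolding iff X_def by (simp add: algebra_simps power2_eq_square power3_eq_cube)
      ultimately show ?thesis by blast
    next
      case False
      then have R: "(Re w)\<^sup>2 + (Im w)\<^sup>2 = 1/2"
        using \<open>w \<in> W\<close> unfolding iff by simp
      have "Re w * (1/2 - 3/2) + 1/30 = 0"
        using \<open>w \<in> W\<close> unfolding iff R by blast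
      then have x: "Re w = 1/30"
        by simp
      with R y have "(Im w)\<^sup>2 = y\<^sup>2"
        by (simp add: power2_eq_square)
      with x show ?thesis
        by (auto simp: power2_eq_iff complex_eq_iff)
    qed
  next
    fix w assume "w \<in> of_real ` X \<union> {Complex (1/30) y, Complex (1/30) (-y)}"
    then show "w \<in> W"
    proof
      assume "w \<in> of_real ` X"
      then show ?thesis
        unfolding iff X_def by (auto simp: algebra_simps power2_eq_square power3_eq_cube)
    next
      assume "w \<in> {Complex (1/30) y, Complex (1/30) (-y)}"
      then show ?thesis
        unfolding iff by (auto simp: y(2) power_divide)
    qed
  qed
  moreover have "of_real ` X \<inter> {Complex (1/30) y, Complex (1/30) (-y)} = {}"
    using y by (auto simp: complex_eq_iff)
  moreover have "finite X" "card X = 3"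
    using card_cubic_zeros by (auto simp: X_def)
  moreover have "card (complex_of_real ` X) = card X"
    by (intro card_image) (auto simp: inj_on_def)
  moreover have "card {Complex (1/30) y, Complex (1/30) (-y)} = 2"
    using y by simp
  ultimately show ?thesis
    using card_Un_disjoint[of "of_real ` X" "{Complex (1/30) y, Complex (1/30) (-y)}"] by simp
qed

lemma rho_f2: "1 \<le> m \<Longrightarrow> rho (f2 m) = 5 * m"
proof -
  assume "1 \<le> m"
  define W where "W = {w. cnj w * (w\<^sup>2 - 1/2) - (w - 1/30) = 0}"
  have "mixed_zeros (f2 m) = {z. \<exists>w\<in>W. z ^ m = w}"
    unfolding mixed_zeros_def f2_def W_def by (simp add: power_mult mult.commute[of 2 m])
  moreover have "card {z. \<exists>w\<in>W. z ^ m = w} = m * card W"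
    using \<open>1 \<le> m\<close> reduced_f2_zeros by (intro card_union_of_root_fibres) (auto simp: W_def)
  ultimately show ?thesis
    using reduced_f2_zeros by (simp add: rho_def W_def)
qed

theorem theorem21:
  "(\<forall>n m n\<^sub>1 :: nat. 0 < n \<longrightarrow> 0 < m \<longrightarrow> 2 * m < n \<longrightarrow> n\<^sub>1 = n + m \<longrightarrow>
      3 * m < n\<^sub>1 \<and>
      (\<forall>\<^sub>F a in at_right (0::real). \<forall>\<^sub>F \<epsilon> in at_right (0::real).
         rho (ell n m a \<epsilon>) = 5 * (n\<^sub>1 - m))) \<and>
   (\<forall>m :: nat. 1 \<le> m \<longrightarrow>
      f2 m \<in> mixed_L (3 * m) (2 * m) m \<and> rho (f2 m) = 5 * m)"
  by (auto simp: f2_in_mixed_L rho_f2 intro: eventually_rho_ell)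

end
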